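(* There exists a constant $C>0$ depending only on the dimension $n$ such that for every $f\in\mathrm{BLO}(\mathbb{R}^n)$, $$\sup_{t>0}\left\|W_tf(\cdot)-\inf_{z\in B(\cdot,\sqrt t)}W_tf(z)\right\|_{L^\infty(\mathbb{R}^n)}\le C\,\|f\|_{\mathrm{BLO}(\mathbb{R}^n)}.$$
   Context: $\mathrm{BLO}(\mathbb{R}^n)$ is the set of real-valued locally integrable functions $f$ on $\mathbb{R}^n$ with $\|f\|_{\mathrm{BLO}(\mathbb{R}^n)}:=\sup_B\frac1{|B|}\int_B\big[f(x)-\operatorname{ess\,inf}_B f\big]\,dx<\infty$, the supremum being over all balls $B\subset\mathbb{R}^n$. The heat semigroup is $W_tf(x)=\int_{\mathbb{R}^n}W_t(x-y)f(y)\,dy$ with $W_t(x-y)=(4\pi t)^{-n/2}\exp(-|x-y|^2/(4t))$, $t>0$. $B(x,r)$ is the ball of center $x$ and radius $r$. *)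

theory Defs
  imports "HOL-Probability.Essential_Supremum"
begin

text \<open>All measures are Lebesgue measure on \<open>\<real>\<^sup>n\<close>, rendered as \<open>real ^ 'n\<close> with
  \<open>n = CARD('n)\<close>.\<close>

definition locally_integrable :: "(real ^ 'n \<Rightarrow> real) \<Rightarrow> bool" where
  "locally_integrable f \<longleftrightarrow> (\<forall>K. compact K \<longrightarrow> f absolutely_integrable_on K)"

definition ess_inf_on :: "(real ^ 'n) set \<Rightarrow> (real ^ 'n \<Rightarrow> real) \<Rightarrow> ereal" where
  "ess_inf_on B f = - esssup (lebesgue_on B) (\<lambda>x. - ereal (f x))"

text \<open>The integrand \<open>f - ess inf\<^sub>B f\<close> is nonnegative almost everywhere on \<open>B\<close>, so
  \<^const>\<open>e2ennreal\<close> changes it only on a null set. If \<open>ess inf\<^sub>B f = -\<infinity>\<close>, the integral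
  is \<open>\<infinity>\<close>.\<close>

definition BLO_norm :: "(real ^ 'n \<Rightarrow> real) \<Rightarrow> ennreal" where
  "BLO_norm f =
    (SUP (x, r) \<in> UNIV \<times> {0<..}.
      (\<integral>\<^sup>+ y\<in>ball x r. e2ennreal (ereal (f y) - ess_inf_on (ball x r) f) \<partial>lebesgue)
        / emeasure lebesgue (ball x r))"

definition BLO :: "(real ^ 'n \<Rightarrow> real) set" where
  "BLO = {f. locally_integrable f \<and> BLO_norm f < \<infinity>}"

definition heat_kernel :: "real \<Rightarrow> real ^ 'n \<Rightarrow> real" where
  "heat_kernel t x =
    (4 * pi * t) powr (- real CARD('n) / 2) * exp (- (norm x)\<^sup>2 / (4 * t))"

text \<open>For \<open>f\<close> in \<open>BLO\<close> and \<open>t > 0\<close> the integral converges absolutely (\<open>BLO \<subseteq> BMO\<close>), so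
  the default value \<open>0\<close> of the Bochner integral plays no role there.\<close>

definition heat_semigroup :: "real \<Rightarrow> (real ^ 'n \<Rightarrow> real) \<Rightarrow> real ^ 'n \<Rightarrow> real" where
  "heat_semigroup t f x = (\<integral>y. heat_kernel t (x - y) * f y \<partial>lebesgue)"

text \<open>Extended-real-valued arguments, since an infimum over a ball may a priori be
  \<open>-\<infinity>\<close>.\<close>

definition Linfty_norm :: "(real ^ 'n \<Rightarrow> ereal) \<Rightarrow> ennreal" where
  "Linfty_norm g = esssup lebesgue (\<lambda>x. e2ennreal \<bar>g x\<bar>)"

end

theory Submission
  imports Defs "HOL-Real_Asymp.Real_Asymp"
begin

text \<open>Only the mean oscillation bound of \<open>f\<close> matters. Comparing the essential infima on two
  concentric balls over the smaller one shows that, for \<open>c\<close> the essential infimum over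
  \<open>B(x, \<surd>t)\<close>, the integral of \<open>|f - c|\<close> over \<open>B(x, (k + 1)\<surd>t)\<close> grows at most polynomially in \<open>k\<close>.
  The Gaussian decay of the kernel, uniform over centres \<open>z\<close> within \<open>\<surd>t\<close> of \<open>x\<close>, then bounds
  \<open>W\<^sub>t(f - c)\<close> at \<open>x\<close> and at \<open>z\<close>, and \<open>W\<^sub>t c\<close> does not depend on the point.\<close>

section \<open>Measurability, essential infima and mean oscillation\<close>

text \<open>At each point the truncations of \<open>f\<close> to the balls \<open>cball 0 k\<close>
  are eventually equal to \<open>f\<close>, and each truncation is integrable.\<close>

lemma locally_integrable_measurable:
  assumes "locally_integrable f"
  shows "f \<in> borel_measurable lebesgue"
proof (rule borel_measurable_LIMSEQ_real)
  fix x :: "real ^ 'a"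
  obtain m where m: "norm x \<le> real m" using real_arch_simple by blast
  have "eventually (\<lambda>k. indicator (cball 0 (real k)) x * f x = f x) sequentially"
    using eventually_ge_at_top[of m] by eventually_elim (use m in \<open>auto simp: indicator_def\<close>)
  then show "(\<lambda>k. indicator (cball 0 (real k)) x * f x) \<longlonglongrightarrow> f x"
    by (rule tendsto_eventually)
next
  fix k
  have "f absolutely_integrable_on cball 0 (real k)"
    using assms by (simp add: locally_integrable_def)
  then show "(\<lambda>x. indicator (cball 0 (real k)) x * f x) \<in> borel_measurable lebesgue"
    unfolding set_integrable_def by (auto dest: borel_measurable_integrable)
qed

text \<open>An essential infimum of plus infinity would make the ball a null set; minus infinity
  would make the integrand identically infinite on a ball of positive measure. With a real value,
  the extended subtraction in \<open>BLO_norm\<close> becomes a real one.\<close>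

lemma ess_inf_on_finite:
  fixes f :: "real ^ 'n \<Rightarrow> real"
  assumes f: "f \<in> borel_measurable lebesgue" and "r > 0"
    and fin: "(\<integral>\<^sup>+ y\<in>ball x r. e2ennreal (ereal (f y) - ess_inf_on (ball x r) f) \<partial>lebesgue) < \<infinity>"
  obtains c where "ess_inf_on (ball x r) f = ereal c"
    "AE y in lebesgue. y \<in> ball x r \<longrightarrow> c \<le> f y"
proof -
  have pos: "emeasure lebesgue (ball x r) > 0"
    using \<open>r > 0\<close> by (simp add: emeasure_ball)
  have ae: "AE y in lebesgue. y \<in> ball x r \<longrightarrow> ess_inf_on (ball x r) f \<le> ereal (f y)"
    using esssup_AE[of "\<lambda>y. - ereal (f y)" "lebesgue_on (ball x r)"]
    by (subst (asm) AE_restrict_space_iff)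
       (auto simp: ess_inf_on_def ereal_uminus_le_reorder elim!: eventually_mono)
  have "ess_inf_on (ball x r) f \<noteq> \<infinity>"
  proof
    assume "ess_inf_on (ball x r) f = \<infinity>"
    with ae have "AE y in lebesgue. y \<notin> ball x r" by auto
    then have "emeasure lebesgue (ball x r) = 0"
      by (subst (asm) AE_iff_measurable[of "ball x r"]) auto
    with pos show False by simp
  qed
  moreover have "ess_inf_on (ball x r) f \<noteq> - \<infinity>"
  proof
    assume "ess_inf_on (ball x r) f = - \<infinity>"
    then have "(\<integral>\<^sup>+ y\<in>ball x r. e2ennreal (ereal (f y) - ess_inf_on (ball x r) f) \<partial>lebesgue)
        = \<infinity> * emeasure lebesgue (ball x r)"
      by (simp add: nn_integral_cmult_indicator)
    with fin pos show False by (auto simp: ennreal_top_mult split: if_splits)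
  qed
  ultimately obtain c where "ess_inf_on (ball x r) f = ereal c"
    by (cases "ess_inf_on (ball x r) f") auto
  with ae that show ?thesis by auto
qed

text \<open>The witness \<open>c\<close> is the essential infimum over the ball:
  \<open>f - c\<close> is nonnegative almost everywhere there, so the absolute value costs nothing.
  The \<open>BLO\<close> bound reaches the later estimates only in this form.\<close>

lemma BLO_mean_oscillation:
  fixes f :: "real ^ 'n \<Rightarrow> real"
  assumes f: "f \<in> BLO" and "r > 0"
  obtains c where "(\<integral>\<^sup>+ y\<in>ball x r. ennreal \<bar>f y - c\<bar> \<partial>lebesgue)
    \<le> BLO_norm f * emeasure lebesgue (ball x r)"
proof -
  let ?B = "ball x r"
  let ?I = "\<integral>\<^sup>+ y\<in>?B. e2ennreal (ereal (f y) - ess_inf_on ?B f) \<partial>lebesgue"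
  have fm: "f \<in> borel_measurable lebesgue" and fin: "BLO_norm f < \<infinity>"
    using f locally_integrable_measurable by (auto simp: BLO_def)
  have pos: "emeasure lebesgue ?B > 0" and top: "emeasure lebesgue ?B < \<infinity>"
    using \<open>r > 0\<close> by (simp_all add: emeasure_ball)
  have "?I / emeasure lebesgue ?B \<le> BLO_norm f"
    unfolding BLO_norm_def by (rule SUP_upper2[of "(x, r)"]) (use \<open>r > 0\<close> in auto)
  then have "?I / emeasure lebesgue ?B * emeasure lebesgue ?B \<le> BLO_norm f * emeasure lebesgue ?B"
    by (rule mult_right_mono) simp
  then have I: "?I \<le> BLO_norm f * emeasure lebesgue ?B"
    using pos top unfolding ennreal_divide_times by (subst (asm) ennreal_divide_self) auto
  then have "?I < \<infinity>"
    using fin top by (auto intro!: le_less_trans[OF I] simp: ennreal_mult_less_top)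
  then obtain c where c: "ess_inf_on ?B f = ereal c" "AE y in lebesgue. y \<in> ?B \<longrightarrow> c \<le> f y"
    using ess_inf_on_finite[OF fm \<open>r > 0\<close>] by blast
  have "(\<integral>\<^sup>+ y\<in>?B. ennreal \<bar>f y - c\<bar> \<partial>lebesgue) = ?I"
    by (rule nn_integral_cong_AE) (use c in \<open>auto elim!: eventually_mono simp: indicator_def\<close>)
  with I show ?thesis by (intro that[of c]) (simp only:)
qed

section \<open>Domination of the heat kernel by weighted balls\<close>

text \<open>Gaussian decay beats every power, so the terms are eventually below a multiple of
  \<open>1 / k ^ 2\<close>.\<close>

lemma summable_gaussian_tail:
  "summable (\<lambda>k. exp (- (real (k - 1))\<^sup>2 / 4) * real (k + 1) ^ m)"
proof (rule summable_comparison_test_bigo)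
  show "summable (\<lambda>k. norm (1 / real k ^ 2))"
    using inverse_power_summable[of 2, where 'a = real] by (simp add: field_simps)
  \<comment> \<open>Real subtraction and \<open>powr\<close> replace truncated subtraction and the
    symbolic power, a form suited to \<open>real_asymp\<close>; the two forms agree from
    \<open>k = 1\<close> on.\<close>
  have "(\<lambda>k::nat. exp (- (real k - 1)\<^sup>2 / 4) * (real k + 1) powr (real m)) \<in> O(\<lambda>k. 1 / real k ^ 2)"
    by real_asymp
  also have "?this \<longleftrightarrow> (\<lambda>k. exp (- (real (k - 1))\<^sup>2 / 4) * real (k + 1) ^ m) \<in> O(\<lambda>k. 1 / real k ^ 2)"
    by (intro landau_o.big.in_cong eventually_mono[OF eventually_ge_at_top[of 1]])
       (auto simp: powr_realpow of_nat_diff add.commute)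
  finally show "(\<lambda>k. exp (- (real (k - 1))\<^sup>2 / 4) * real (k + 1) ^ m) \<in> O(\<lambda>k. 1 / real k ^ 2)" .
qed

lemma heat_kernel_measurable [measurable]:
  "heat_kernel t \<in> borel_measurable borel"
  unfolding heat_kernel_def by measurable

lemma heat_kernel_pos: "t > 0 \<Longrightarrow> heat_kernel t x > 0"
  by (simp add: heat_kernel_def)

text \<open>The truncated subtraction \<open>k - 1\<close> absorbs the distance between the centres \<open>x\<close> and \<open>z\<close>.\<close>

lemma heat_kernel_le_suminf:
  fixes x y z :: "real ^ 'n"
  assumes "t > 0" and xz: "dist x z \<le> sqrt t"
  shows "ennreal (heat_kernel t (z - y)) \<le>
    (\<Sum>k. ennreal ((4 * pi * t) powr (- real CARD('n) / 2) * exp (- (real (k - 1))\<^sup>2 / 4))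
      * indicator (ball x (real (k + 1) * sqrt t)) y)"
proof -
  \<comment> \<open>The index of the annulus around \<open>x\<close>, of width
    \<open>sqrt t\<close>, that contains \<open>y\<close>. The single term at this \<open>k\<close>
    already dominates the kernel.\<close>
  define k where "k = nat \<lfloor>dist x y / sqrt t\<rfloor>"
  have s: "sqrt t > 0" using \<open>t > 0\<close> by simp
  have "real k \<le> dist x y / sqrt t" "dist x y / sqrt t < real k + 1"
    using s by (simp_all add: k_def)
  then have k: "real k * sqrt t \<le> dist x y" "dist x y < real (k + 1) * sqrt t"
    using s by (simp_all add: field_simps)
  have "real (k - 1) * sqrt t \<le> norm (z - y)"
  proof (cases k)
    case (Suc j)
    then have "real (k - 1) * sqrt t \<le> dist x y - dist x z"
      using k(1) xz by (simp add: algebra_simps)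
    also have "\<dots> \<le> dist z y" using dist_triangle[of x y z] by simp
    finally show ?thesis by (simp add: dist_norm)
  qed simp
  then have "(real (k - 1) * sqrt t)\<^sup>2 \<le> (norm (z - y))\<^sup>2"
    using s by (intro power_mono) auto
  then have "(real (k - 1))\<^sup>2 / 4 \<le> (norm (z - y))\<^sup>2 / (4 * t)"
    using \<open>t > 0\<close> by (simp add: power_mult_distrib field_simps)
  moreover define F where "F j = ennreal ((4 * pi * t) powr (- real CARD('n) / 2)
    * exp (- (real (j - 1))\<^sup>2 / 4)) * indicator (ball x (real (j + 1) * sqrt t)) y" for j :: nat
  ultimately have "ennreal (heat_kernel t (z - y)) \<le> F k"
    using k(2) by (auto simp: heat_kernel_def intro!: ennreal_leI mult_left_mono)
  also have "F k = sum F {k}" by simp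
  also have "\<dots> \<le> suminf F" by (rule sum_le_suminf) auto
  finally show ?thesis unfolding F_def .
qed

text \<open>The factor \<open>(4 * pi) powr (- n / 2)\<close> is what remains of the kernel's
  prefactor once its power of \<open>t\<close> is cancelled. In the exponent \<open>2 * n\<close>,
  one \<open>n\<close> comes from the volume of the balls, the other from the drift of the constants
  between balls.\<close>

definition gaussian_tail :: "nat \<Rightarrow> real" where
  "gaussian_tail n = (4 * pi) powr (- real n / 2)
    * (\<Sum>k. exp (- (real (k - 1))\<^sup>2 / 4) * real (k + 1) ^ (2 * n))"

lemma gaussian_tail_nonneg: "gaussian_tail n \<ge> 0"
  unfolding gaussian_tail_def by (intro mult_nonneg_nonneg suminf_nonneg summable_gaussian_tail) auto

text \<open>The dominating series is integrated term by term. The kernel's factor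
  \<open>t powr (- n / 2)\<close> cancels \<open>sqrt t ^ n\<close> from the growth hypothesis,
  which makes the bound independent of \<open>t\<close>. Growth is measured around \<open>x\<close>
  although the kernel is centred at \<open>z\<close>.\<close>

lemma nn_integral_heat_kernel_le:
  fixes x z :: "real ^ 'n"
  assumes "t > 0" and xz: "dist x z \<le> sqrt t" and "M \<ge> 0"
    and g [measurable]: "g \<in> borel_measurable lebesgue"
    and growth: "\<And>k. (\<integral>\<^sup>+ y\<in>ball x (real (k + 1) * sqrt t). g y \<partial>lebesgue)
      \<le> ennreal (M * sqrt t ^ CARD('n) * real (k + 1) ^ (2 * CARD('n)))"
  shows "(\<integral>\<^sup>+ y. ennreal (heat_kernel t (z - y)) * g y \<partial>lebesgue)
    \<le> ennreal (M * gaussian_tail CARD('n))"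
proof -
  let ?a = "(4 * pi * t) powr (- real CARD('n) / 2)"
  have [measurable]: "ball x s \<in> sets lebesgue" for s by simp
  define m where "m k = ?a * exp (- (real (k - 1))\<^sup>2 / 4)" for k :: nat
  have scale: "?a * sqrt t ^ CARD('n) = (4 * pi) powr (- real CARD('n) / 2)"
  proof -
    have "sqrt t ^ CARD('n) = t powr (real CARD('n) / 2)"
      using \<open>t > 0\<close> by (simp add: powr_half_sqrt[symmetric] powr_power)
    then show ?thesis
      using \<open>t > 0\<close> by (simp add: powr_mult powr_add[symmetric] mult.assoc)
  qed
  have "(\<integral>\<^sup>+ y. ennreal (heat_kernel t (z - y)) * g y \<partial>lebesgue)
      \<le> (\<integral>\<^sup>+ y. (\<Sum>k. ennreal (m k) * (g y * indicator (ball x (real (k + 1) * sqrt t)) y)) \<partial>lebesgue)"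
  proof (rule nn_integral_mono)
    fix y
    have "ennreal (heat_kernel t (z - y)) * g y
        \<le> (\<Sum>k. ennreal (m k) * indicator (ball x (real (k + 1) * sqrt t)) y) * g y"
      using heat_kernel_le_suminf[OF \<open>t > 0\<close> xz, of y] unfolding m_def by (intro mult_right_mono) auto
    also have "\<dots> = (\<Sum>k. ennreal (m k) * (g y * indicator (ball x (real (k + 1) * sqrt t)) y))"
      unfolding ennreal_suminf_multc[symmetric] by (simp only: mult_ac)
    finally show "ennreal (heat_kernel t (z - y)) * g y \<le> \<dots>" .
  qed
  also have "\<dots> = (\<Sum>k. ennreal (m k) * (\<integral>\<^sup>+ y\<in>ball x (real (k + 1) * sqrt t). g y \<partial>lebesgue))"
    by (subst nn_integral_suminf) (simp_all add: nn_integral_cmult)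
  also have "\<dots> \<le> (\<Sum>k. ennreal (M * (4 * pi) powr (- real CARD('n) / 2)
      * (exp (- (real (k - 1))\<^sup>2 / 4) * real (k + 1) ^ (2 * CARD('n)))))"
  proof (intro suminf_le summableI)
    fix k
    have "ennreal (m k) * (\<integral>\<^sup>+ y\<in>ball x (real (k + 1) * sqrt t). g y \<partial>lebesgue)
        \<le> ennreal (m k) * ennreal (M * sqrt t ^ CARD('n) * real (k + 1) ^ (2 * CARD('n)))"
      by (rule mult_left_mono[OF growth]) simp
    also have "\<dots> = ennreal (M * (?a * sqrt t ^ CARD('n))
        * (exp (- (real (k - 1))\<^sup>2 / 4) * real (k + 1) ^ (2 * CARD('n))))"
      using \<open>M \<ge> 0\<close> \<open>t > 0\<close> by (subst ennreal_mult[symmetric]) (auto simp: m_def mult_ac)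
    finally show "ennreal (m k) * (\<integral>\<^sup>+ y\<in>ball x (real (k + 1) * sqrt t). g y \<partial>lebesgue)
        \<le> ennreal (M * (4 * pi) powr (- real CARD('n) / 2)
          * (exp (- (real (k - 1))\<^sup>2 / 4) * real (k + 1) ^ (2 * CARD('n))))"
      unfolding scale .
  qed
  also have "\<dots> = ennreal (M * gaussian_tail CARD('n))"
    using \<open>M \<ge> 0\<close> summable_gaussian_tail
    by (subst suminf_ennreal2)
       (auto simp: gaussian_tail_def suminf_mult mult.assoc simp del: of_nat_add
         intro!: summable_mult)
  finally show ?thesis .
qed


lemma ennreal_abs_diff_triangle:
  "ennreal \<bar>a - b\<bar> \<le> ennreal \<bar>a - c\<bar> + ennreal \<bar>c - b\<bar>"
  by (simp add: ennreal_plus[symmetric] ennreal_leI del: ennreal_plus)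

text \<open>One constant, taken from the smallest ball, has to serve all balls. Replacing
  \<open>c k\<close> by \<open>c 0\<close> costs at most \<open>2 * N * q k\<close>; integrating
  this over \<open>B k\<close> brings a second factor \<open>q k\<close>, hence the doubled
  exponent.\<close>

lemma BLO_growth:
  fixes f :: "real ^ 'n \<Rightarrow> real"
  assumes f: "f \<in> BLO" and "r > 0"
  obtains c where "\<And>k. (\<integral>\<^sup>+ y\<in>ball x (real (k + 1) * r). ennreal \<bar>f y - c\<bar> \<partial>lebesgue)
    \<le> ennreal (3 * enn2real (BLO_norm f) * unit_ball_vol (real CARD('n)) * r ^ CARD('n)
        * real (k + 1) ^ (2 * CARD('n)))"
proof -
  define B where "B k = ball x (real (k + 1) * r)" for k
  define N where "N = enn2real (BLO_norm f)"
  define V where "V = unit_ball_vol (real CARD('n)) * r ^ CARD('n)"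
  define q where "q k = real (k + 1) ^ CARD('n)" for k
  have fm [measurable]: "f \<in> borel_measurable lebesgue" and N: "BLO_norm f = ennreal N" "N \<ge> 0"
    using f locally_integrable_measurable by (auto simp: BLO_def N_def)
  have [measurable]: "B k \<in> sets lebesgue" for k by (simp add: B_def)
  have V: "V > 0" using \<open>r > 0\<close> by (simp add: V_def)
  have q: "q k \<ge> 1" and q0: "q 0 = 1" for k by (auto simp: q_def intro!: one_le_power)
  have vol: "emeasure lebesgue (B k) = ennreal (V * q k)" for k
    using \<open>r > 0\<close> by (simp add: B_def V_def q_def emeasure_ball power_mult_distrib mult_ac)
  have sub: "B 0 \<subseteq> B k" for k
    using \<open>r > 0\<close> unfolding B_def by (intro subset_ball) (simp add: algebra_simps)
  have "\<exists>c. (\<integral>\<^sup>+ y\<in>B k. ennreal \<bar>f y - c\<bar> \<partial>lebesgue) \<le> ennreal (N * (V * q k))" for k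
  proof -
    have "real (k + 1) * r > 0" using \<open>r > 0\<close> by simp
    from BLO_mean_oscillation[OF f this, of x] obtain c where
      "(\<integral>\<^sup>+ y\<in>B k. ennreal \<bar>f y - c\<bar> \<partial>lebesgue) \<le> BLO_norm f * emeasure lebesgue (B k)"
      unfolding B_def .
    also have "\<dots> = ennreal (N * (V * q k))"
      unfolding vol N(1) using N(2) V q[of k] by (simp add: ennreal_mult)
    finally show ?thesis by blast
  qed
  then obtain c where c: "\<And>k. (\<integral>\<^sup>+ y\<in>B k. ennreal \<bar>f y - c k\<bar> \<partial>lebesgue) \<le> ennreal (N * (V * q k))"
    by metis
  \<comment> \<open>Both oscillation bounds can be used on the smaller ball \<open>B 0\<close>.
    Division by its volume \<open>V\<close> leaves the volume ratio \<open>q k\<close> in the bound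
    coming from \<open>B k\<close>.\<close>
  have diff: "\<bar>c k - c 0\<bar> \<le> 2 * N * q k" for k
  proof -
    have "ennreal (\<bar>c k - c 0\<bar> * V) = ennreal \<bar>c k - c 0\<bar> * emeasure lebesgue (B 0)"
      using V by (simp add: vol q0 ennreal_mult)
    also have "\<dots> = (\<integral>\<^sup>+ y\<in>B 0. ennreal \<bar>c k - c 0\<bar> \<partial>lebesgue)"
      by (simp add: nn_integral_cmult_indicator)
    also have "\<dots> \<le> (\<integral>\<^sup>+ y. ennreal \<bar>f y - c k\<bar> * indicator (B k) y
        + ennreal \<bar>f y - c 0\<bar> * indicator (B 0) y \<partial>lebesgue)"
    proof (rule nn_integral_mono)
      fix y
      show "ennreal \<bar>c k - c 0\<bar> * indicator (B 0) y \<le>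
          ennreal \<bar>f y - c k\<bar> * indicator (B k) y + ennreal \<bar>f y - c 0\<bar> * indicator (B 0) y"
        using ennreal_abs_diff_triangle[of "c k" "c 0" "f y"] sub[of k]
        by (cases "y \<in> B 0") (auto simp: abs_minus_commute)
    qed
    also have "\<dots> = (\<integral>\<^sup>+ y\<in>B k. ennreal \<bar>f y - c k\<bar> \<partial>lebesgue) + (\<integral>\<^sup>+ y\<in>B 0. ennreal \<bar>f y - c 0\<bar> \<partial>lebesgue)"
      by (rule nn_integral_add) measurable
    also have "\<dots> \<le> ennreal (N * (V * q k)) + ennreal (N * (V * q 0))"
      by (intro add_mono c)
    also have "\<dots> = ennreal (N * (q k + 1) * V)"
      using N V q[of k]
      by (simp add: q0 ennreal_plus[symmetric] distrib_left distrib_right mult_ac del: ennreal_plus)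
    finally have "\<bar>c k - c 0\<bar> * V \<le> N * (q k + 1) * V"
      using N V q[of k] by (subst (asm) ennreal_le_iff) auto
    then have "\<bar>c k - c 0\<bar> \<le> N * (q k + 1)"
      using V by (rule mult_right_le_imp_le)
    also have "\<dots> \<le> N * (2 * q k)"
      using N q[of k] by (intro mult_left_mono) auto
    finally show ?thesis by simp
  qed
  show ?thesis
  proof
    fix k
    have "(\<integral>\<^sup>+ y\<in>B k. ennreal \<bar>f y - c 0\<bar> \<partial>lebesgue)
        \<le> (\<integral>\<^sup>+ y. ennreal \<bar>f y - c k\<bar> * indicator (B k) y
          + ennreal \<bar>c k - c 0\<bar> * indicator (B k) y \<partial>lebesgue)"
    proof (rule nn_integral_mono)
      fix y
      show "ennreal \<bar>f y - c 0\<bar> * indicator (B k) y \<le>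
          ennreal \<bar>f y - c k\<bar> * indicator (B k) y + ennreal \<bar>c k - c 0\<bar> * indicator (B k) y"
        using ennreal_abs_diff_triangle[of "f y" "c 0" "c k"] by (cases "y \<in> B k") auto
    qed
    also have "\<dots> = (\<integral>\<^sup>+ y\<in>B k. ennreal \<bar>f y - c k\<bar> \<partial>lebesgue) + (\<integral>\<^sup>+ y\<in>B k. ennreal \<bar>c k - c 0\<bar> \<partial>lebesgue)"
      by (rule nn_integral_add) measurable
    also have "\<dots> = (\<integral>\<^sup>+ y\<in>B k. ennreal \<bar>f y - c k\<bar> \<partial>lebesgue) + ennreal \<bar>c k - c 0\<bar> * emeasure lebesgue (B k)"
      by (simp add: nn_integral_cmult_indicator)
    also have "\<dots> \<le> ennreal (N * (V * q k)) + ennreal (2 * N * q k) * ennreal (V * q k)"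
      unfolding vol by (intro add_mono c mult_right_mono ennreal_leI diff) auto
    also have "\<dots> = ennreal (N * V * q k + 2 * (N * V * q k * q k))"
      using N V q[of k]
      by (simp add: ennreal_mult[symmetric] ennreal_plus[symmetric] mult_ac del: ennreal_plus)
    \<comment> \<open>Since \<open>q k \<ge> 1\<close>, the linear term is absorbed into the
      quadratic one, and 3 = 1 + 2.\<close>
    also have "\<dots> \<le> ennreal (3 * (N * V * q k * q k))"
    proof (rule ennreal_leI)
      have "N * V * q k * 1 \<le> N * V * q k * q k"
        using N V q[of k] by (intro mult_left_mono) auto
      then show "N * V * q k + 2 * (N * V * q k * q k) \<le> 3 * (N * V * q k * q k)"
        by linarith
    qed
    also have "3 * (N * V * q k * q k) = 3 * enn2real (BLO_norm f) * unit_ball_vol (real CARD('n))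
        * r ^ CARD('n) * real (k + 1) ^ (2 * CARD('n))"
      by (simp add: N_def V_def q_def mult_2 power_add mult.assoc)
    finally show "(\<integral>\<^sup>+ y\<in>ball x (real (k + 1) * r). ennreal \<bar>f y - c 0\<bar> \<partial>lebesgue) \<le> ennreal \<dots>"
      unfolding B_def .
  qed
qed

section \<open>Integrability and oscillation of the heat semigroup\<close>

lemma heat_kernel_lebesgue_measurable [measurable]:
  "(\<lambda>y. heat_kernel t (z - y)) \<in> borel_measurable lebesgue"
  by (rule measurable_completion) measurable

text \<open>Both claims come from one finite bound on the integral of the absolute value.
  Integrability makes the Bochner integral genuine rather than its default 0.\<close>

lemma
  fixes x z :: "real ^ 'n" and h :: "real ^ 'n \<Rightarrow> real"
  assumes t: "t > 0" and xz: "dist x z \<le> sqrt t" and M: "M \<ge> 0"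
    and h [measurable]: "h \<in> borel_measurable lebesgue"
    and growth: "\<And>k. (\<integral>\<^sup>+ y\<in>ball x (real (k + 1) * sqrt t). ennreal \<bar>h y\<bar> \<partial>lebesgue)
      \<le> ennreal (M * sqrt t ^ CARD('n) * real (k + 1) ^ (2 * CARD('n)))"
  shows integrable_heat_kernel_mult: "integrable lebesgue (\<lambda>y. heat_kernel t (z - y) * h y)"
    and heat_semigroup_bound: "\<bar>heat_semigroup t h z\<bar> \<le> M * gaussian_tail CARD('n)"
proof -
  have *: "(\<integral>\<^sup>+ y. ennreal (norm (heat_kernel t (z - y) * h y)) \<partial>lebesgue) \<le> ennreal (M * gaussian_tail CARD('n))"
    using nn_integral_heat_kernel_le[OF t xz M _ growth] heat_kernel_pos[OF t, of "z - _"]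
    by (simp add: abs_mult ennreal_mult less_imp_le)
  show int: "integrable lebesgue (\<lambda>y. heat_kernel t (z - y) * h y)"
    by (rule integrableI_bounded) (use * in \<open>auto intro: le_less_trans\<close>)
  have "ennreal (norm (heat_semigroup t h z)) \<le> ennreal (M * gaussian_tail CARD('n))"
    unfolding heat_semigroup_def by (rule order_trans[OF integral_norm_bound_ennreal[OF int] *])
  then show "\<bar>heat_semigroup t h z\<bar> \<le> M * gaussian_tail CARD('n)"
    using M gaussian_tail_nonneg by (subst (asm) ennreal_le_iff) auto
qed

text \<open>By translation invariance of Lebesgue measure and evenness of the kernel, both sides
  equal the same integral centred at the origin. Constants therefore drop out of differences of the
  semigroup.\<close>

lemma heat_semigroup_const:
  fixes x z :: "real ^ 'n"
  shows "heat_semigroup t (\<lambda>_. c) z = heat_semigroup t (\<lambda>_. c) x"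
proof -
  have "heat_semigroup t (\<lambda>_. c) z = (\<integral>y. heat_kernel t (y :: real ^ 'n) * c \<partial>lborel)" for z :: "real ^ 'n"
  proof -
    have "(\<integral>y. heat_kernel t (y :: real ^ 'n) * c \<partial>lborel) = (\<integral>y. heat_kernel t (y :: real ^ 'n) * c \<partial>distr lborel borel ((+) (- z)))"
      by (simp only: lborel_distr_plus)
    also have "\<dots> = (\<integral>y. heat_kernel t (- z + y) * c \<partial>lborel)"
      by (rule integral_distr) auto
    also have "\<dots> = heat_semigroup t (\<lambda>_. c) z"
      unfolding heat_semigroup_def
      by (subst integral_completion) (auto simp: heat_kernel_def norm_minus_commute)
    finally show ?thesis by simp
  qed
  then show ?thesis by metis
qed

text \<open>The constant \<open>c\<close> and the growth bound belong to balls around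
  \<open>x\<close>, yet they serve both points, since \<open>x\<close> and \<open>z\<close> both lie
  within \<open>sqrt t\<close> of \<open>x\<close>. The factor 6 is the 3 of the growth bound,
  counted once for each point.\<close>

lemma heat_semigroup_oscillation:
  fixes f :: "real ^ 'n \<Rightarrow> real"
  assumes f: "f \<in> BLO" and t: "t > 0" and xz: "dist x z \<le> sqrt t"
  shows "\<bar>heat_semigroup t f x - heat_semigroup t f z\<bar>
    \<le> 6 * unit_ball_vol (real CARD('n)) * gaussian_tail CARD('n) * enn2real (BLO_norm f)"
proof -
  let ?v = "unit_ball_vol (real CARD('n))" and ?N = "enn2real (BLO_norm f)"
  have [measurable]: "f \<in> borel_measurable lebesgue"
    using f locally_integrable_measurable by (auto simp: BLO_def)
  have s: "sqrt t > 0" and xx: "dist x x \<le> sqrt t" using t by auto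
  obtain c where c: "\<And>k. (\<integral>\<^sup>+ y\<in>ball x (real (k + 1) * sqrt t). ennreal \<bar>f y - c\<bar> \<partial>lebesgue)
      \<le> ennreal (3 * ?N * ?v * sqrt t ^ CARD('n) * real (k + 1) ^ (2 * CARD('n)))"
    using BLO_growth[OF f s] by blast
  \<comment> \<open>This growth bound yields only the integrability of the kernel times
    \<open>c\<close>; its size, which depends on \<open>c\<close>, never enters the final
    estimate.\<close>
  have const: "(\<integral>\<^sup>+ y\<in>ball x (real (k + 1) * sqrt t). ennreal \<bar>c\<bar> \<partial>lebesgue)
      \<le> ennreal (\<bar>c\<bar> * ?v * sqrt t ^ CARD('n) * real (k + 1) ^ (2 * CARD('n)))" for k
  proof -
    have "(\<integral>\<^sup>+ y\<in>ball x (real (k + 1) * sqrt t). ennreal \<bar>c\<bar> \<partial>lebesgue)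
        = ennreal (\<bar>c\<bar> * (?v * (real (k + 1) * sqrt t) ^ CARD('n)))"
      using t by (simp add: nn_integral_cmult_indicator emeasure_ball ennreal_mult)
    also have "\<dots> \<le> ennreal (\<bar>c\<bar> * ?v * sqrt t ^ CARD('n) * real (k + 1) ^ (2 * CARD('n)))"
    proof (rule ennreal_leI)
      have "real (k + 1) ^ CARD('n) \<le> real (k + 1) ^ (2 * CARD('n))"
        by (rule power_increasing) auto
      then have "(\<bar>c\<bar> * ?v * sqrt t ^ CARD('n)) * real (k + 1) ^ CARD('n)
          \<le> (\<bar>c\<bar> * ?v * sqrt t ^ CARD('n)) * real (k + 1) ^ (2 * CARD('n))"
        using t by (intro mult_left_mono) auto
      then show "\<bar>c\<bar> * (?v * (real (k + 1) * sqrt t) ^ CARD('n))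
          \<le> \<bar>c\<bar> * ?v * sqrt t ^ CARD('n) * real (k + 1) ^ (2 * CARD('n))"
        by (simp add: power_mult_distrib mult_ac)
    qed
    finally show ?thesis .
  qed
  have M: "3 * ?N * ?v \<ge> 0" "\<bar>c\<bar> * ?v \<ge> 0" by auto
  \<comment> \<open>Additivity of the Bochner integral requires both summands to be integrable,
    hence the two growth bounds.\<close>
  have split: "heat_semigroup t f w = heat_semigroup t (\<lambda>y. f y - c) w + heat_semigroup t (\<lambda>_. c) w"
    if w: "dist x w \<le> sqrt t" for w
  proof -
    have "integrable lebesgue (\<lambda>y. heat_kernel t (w - y) * (f y - c))"
      by (rule integrable_heat_kernel_mult[OF t w M(1) _ c]) measurable
    moreover have "integrable lebesgue (\<lambda>y. heat_kernel t (w - y) * c)"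
      by (rule integrable_heat_kernel_mult[OF t w M(2) _ const]) measurable
    ultimately have "(\<integral>y. heat_kernel t (w - y) * (f y - c) + heat_kernel t (w - y) * c \<partial>lebesgue)
        = heat_semigroup t (\<lambda>y. f y - c) w + heat_semigroup t (\<lambda>_. c) w"
      unfolding heat_semigroup_def by (rule Bochner_Integration.integral_add)
    then show ?thesis by (simp add: heat_semigroup_def flip: distrib_left)
  qed
  have "\<bar>heat_semigroup t (\<lambda>y. f y - c) w\<bar> \<le> 3 * ?N * ?v * gaussian_tail CARD('n)"
    if "dist x w \<le> sqrt t" for w
    using heat_semigroup_bound[OF t that M(1) _ c] by simp
  from this[OF xx] this[OF xz] show ?thesis
    unfolding split[OF xx] split[OF xz] heat_semigroup_const[of t c z x] by (simp add: mult_ac)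
qed

section \<open>Measurability and the supremum norm\<close>

text \<open>A Borel function equal to \<open>f\<close> almost everywhere gives the same integrals
  and makes the integrand jointly Borel in \<open>x\<close> and \<open>y\<close>, so the parameter
  integral is Borel.\<close>

lemma heat_semigroup_measurable:
  fixes f :: "real ^ 'n \<Rightarrow> real"
  assumes f: "f \<in> borel_measurable lebesgue"
  shows "heat_semigroup t f \<in> borel_measurable borel"
proof -
  obtain g where g [measurable]: "g \<in> borel_measurable lborel" and eq: "AE y in lborel. f y = g y"
    using completion_ex_borel_measurable_real[OF f] by blast
  note f [measurable]
  have gl [measurable]: "g \<in> borel_measurable lebesgue"
    using g by (rule measurable_completion)
  have "heat_semigroup t f x = (\<integral>y. heat_kernel t (x - y) * g y \<partial>lborel)" for x
  proof -
    have "heat_semigroup t f x = (\<integral>y. heat_kernel t (x - y) * g y \<partial>lebesgue)"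
      unfolding heat_semigroup_def
      by (rule integral_cong_AE) (use AE_completion[OF eq] in \<open>auto elim!: eventually_mono\<close>)
    then show ?thesis by (subst (asm) integral_completion) auto
  qed
  then have "heat_semigroup t f = (\<lambda>x. \<integral>y. heat_kernel t (x - y) * g y \<partial>lborel)" by auto
  also have "\<dots> \<in> borel_measurable borel"
    by (rule lborel.borel_measurable_lebesgue_integral) measurable
  finally show ?thesis .
qed

text \<open>The infimum is uncountable, but over open balls it is upper semicontinuous for arbitrary
  \<open>u\<close>: by symmetry of the distance, a strict sublevel set is a union of open
  balls.\<close>

lemma INF_ball_measurable:
  fixes u :: "'a :: metric_space \<Rightarrow> ereal"
  shows "(\<lambda>x. INF z\<in>ball x r. u z) \<in> borel_measurable borel"
proof (rule borel_measurableI_less)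
  fix a
  have "{x \<in> space borel. (INF z\<in>ball x r. u z) < a} = (\<Union>z\<in>{z. u z < a}. ball z r)"
    by (auto simp: INF_less_iff dist_commute)
  also have "\<dots> \<in> sets borel" by (intro borel_open open_UN) auto
  finally show "{x \<in> space borel. (INF z\<in>ball x r. u z) < a} \<in> sets borel" .
qed

lemma Linfty_norm_heat_semigroup_le:
  fixes f :: "real ^ 'n \<Rightarrow> real"
  assumes f: "f \<in> BLO" and t: "t > 0"
  shows "Linfty_norm (\<lambda>x. ereal (heat_semigroup t f x)
      - (INF z\<in>ball x (sqrt t). ereal (heat_semigroup t f z)))
    \<le> ennreal (6 * unit_ball_vol (real CARD('n)) * gaussian_tail CARD('n) * enn2real (BLO_norm f))"
    (is "Linfty_norm (\<lambda>x. ?W x - ?I x) \<le> ennreal ?C")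
  unfolding Linfty_norm_def
\<comment> \<open>The essential supremum of a non-measurable function is \<open>top\<close> by
  default, so measurability is a real obligation beside the pointwise bound.\<close>
proof (rule esssup_I)
  have "f \<in> borel_measurable lebesgue"
    using f locally_integrable_measurable by (auto simp: BLO_def)
  then have [measurable]: "heat_semigroup t f \<in> borel_measurable borel"
    by (rule heat_semigroup_measurable)
  note INF_ball_measurable [measurable]
  show "(\<lambda>x. e2ennreal \<bar>?W x - ?I x\<bar>) \<in> borel_measurable lebesgue"
    by (rule measurable_completion) measurable
  show "AE x in lebesgue. e2ennreal \<bar>?W x - ?I x\<bar> \<le> ennreal ?C"
  proof (rule AE_I2)
    fix x
    have le: "?I x \<le> ?W x" by (rule INF_lower) (use t in auto)
    have ge: "ereal (heat_semigroup t f x - ?C) \<le> ?I x"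
    proof (rule INF_greatest)
      fix z assume "z \<in> ball x (sqrt t)"
      then have "dist x z \<le> sqrt t" by simp
      from heat_semigroup_oscillation[OF f t this]
      show "ereal (heat_semigroup t f x - ?C) \<le> ereal (heat_semigroup t f z)" by simp
    qed
    \<comment> \<open>Real bounds on both sides exclude infinite values of the infimum, so the
      extended difference is a real one.\<close>
    from le ge obtain i where i: "?I x = ereal i" by (cases "?I x") auto
    with le ge have "\<bar>heat_semigroup t f x - i\<bar> \<le> ?C" by simp
    then show "e2ennreal \<bar>?W x - ?I x\<bar> \<le> ennreal ?C"
      unfolding i by (simp add: ennreal_leI)
  qed
qed

theorem theorem1p3:
  "\<exists>C::real. C > 0 \<and>
    (\<forall>f \<in> (BLO :: (real ^ 'n \<Rightarrow> real) set).
      (SUP t\<in>{0<..}.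
        Linfty_norm (\<lambda>x. ereal (heat_semigroup t f x)
          - (INF z\<in>ball x (sqrt t). ereal (heat_semigroup t f z))))
      \<le> ennreal C * BLO_norm f)"
proof (intro exI conjI ballI SUP_least)
  let ?C = "6 * unit_ball_vol (real CARD('n)) * gaussian_tail CARD('n)"
  have C: "?C \<ge> 0" using gaussian_tail_nonneg by simp
  \<comment> \<open>\<open>gaussian_tail\<close> is only known to be nonnegative; adding 1 gives the
    strict positivity.\<close>
  then show "?C + 1 > 0" by linarith
  fix f :: "real ^ 'n \<Rightarrow> real" and t :: real
  assume f: "f \<in> BLO" and t: "t \<in> {0<..}"
  \<comment> \<open>Membership in \<open>BLO\<close> makes the norm finite, so the conversion to a
    real number loses nothing.\<close>
  from f have N: "ennreal (enn2real (BLO_norm f)) = BLO_norm f" by (auto simp: BLO_def)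
  have "Linfty_norm (\<lambda>x. ereal (heat_semigroup t f x)
      - (INF z\<in>ball x (sqrt t). ereal (heat_semigroup t f z))) \<le> ennreal (?C * enn2real (BLO_norm f))"
    using Linfty_norm_heat_semigroup_le[OF f] t by simp
  also have "\<dots> = ennreal ?C * BLO_norm f"
    using C by (subst N[symmetric], subst ennreal_mult) auto
  also have "\<dots> \<le> ennreal (?C + 1) * BLO_norm f"
    by (intro mult_right_mono ennreal_leI) auto
  finally show "Linfty_norm (\<lambda>x. ereal (heat_semigroup t f x)
      - (INF z\<in>ball x (sqrt t). ereal (heat_semigroup t f z))) \<le> ennreal (?C + 1) * BLO_norm f" .
qed

end
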